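(* Let $\mathcal D$ be a probability distribution on $\mathcal X\times\mathcal Y$, let $\mathbf h\in\mathcal H$ be a fixed hypothesis (chosen independently of the sample) for which $b_{\mathcal D}^Q(\mathbf h)$ and $c_{\mathcal D}^Q(\mathbf h)$ are well defined, let $m\ge1$, and let $\delta_1,\delta_2,\delta_3\in[0,1]$. For each sample $S\in(\mathcal X\times\mathcal Y)^m$ and each probability distribution $Q$ over $\mathcal H$, let $\tilde L_S^Q,\tilde b_S^Q,\tilde c_S^Q$ be real numbers such that (1) $\mathbb P_{S\sim\mathcal D^m}\big(\forall Q\text{ over }\mathcal H:\ \mathbb E_{\mathbf h'\sim Q}\mathcal L_{\mathcal D}(\mathbf h')\le\tilde L_S^Q\big)\ge1-\delta_1$; (2) $\mathbb P_{S\sim\mathcal D^m}\big(\forall Q\text{ over }\mathcal H:\ b_{\mathcal D}^Q(\mathbf h)\ge\tilde b_S^Q\big)\ge1-\delta_2$; (3) $\mathbb P_{S\sim\mathcal D^m}\big(\forall Q\text{ over }\mathcal H:\ c_{\mathcal D}^Q(\mathbf h)\ge\tilde c_S^Q\big)\ge1-\delta_3$; (4) $\tilde c_S^Q>\tilde b_S^Q$ for all $S$ and $Q$. Then, with $\widehat\delta=\delta_1+\delta_2+\delta_3$, $$\mathbb P_{S\sim\mathcal D^m}\left(\forall Q\text{ over }\mathcal H:\ \mathcal L_{\mathcal D}(\mathbf h)\le\frac{\tilde L_S^Q-\tilde b_S^Q}{\tilde c_S^Q-\tilde b_S^Q}\right)\ge1-\widehat\delta.$$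
   Context: $\mathcal X$ is a feature space, $\mathcal Y$ a finite label set, $\mathcal H$ a set of predictors $\mathbf h:\mathcal X\to\mathcal Y'$, and $\ell:\mathcal Y'\times\mathcal Y\to\{0,1\}$ a binary loss (all objects and events are assumed measurable as needed). $\mathcal L_{\mathcal D}(\mathbf h)=\mathbb E_{(\mathbf x,\mathbf y)\sim\mathcal D}[\ell(\mathbf h(\mathbf x),\mathbf y)]$. Define $$b_{\mathcal D}^Q(\mathbf h)=\mathbb E_{(\mathbf x,\mathbf y)\sim\mathcal D}\Big[\mathbb E_{\mathbf h'\sim Q}\,\ell(\mathbf h'(\mathbf x),\mathbf y)\,\Big|\,\ell(\mathbf h(\mathbf x),\mathbf y)=0\Big],\qquad c_{\mathcal D}^Q(\mathbf h)=\mathbb E_{(\mathbf x,\mathbf y)\sim\mathcal D}\Big[\mathbb E_{\mathbf h'\sim Q}\,\ell(\mathbf h'(\mathbf x),\mathbf y)\,\Big|\,\ell(\mathbf h(\mathbf x),\mathbf y)=1\Big],$$ well defined when the conditioning events have positive $\mathcal D$-probability. *)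

theory Defs
  imports "HOL-Probability.Probability"
begin

definition risk :: "('p \<Rightarrow> 'y \<Rightarrow> real) \<Rightarrow> ('x \<times> 'y) measure \<Rightarrow> ('x \<Rightarrow> 'p) \<Rightarrow> real" where
  "risk loss D h = (\<integral>z. loss (h (fst z)) (snd z) \<partial>D)"

text \<open>For an event \<open>A\<close> of positive probability, \<^const>\<open>uniform_measure\<close> \<open>D A\<close> is the conditional
  law of \<open>D\<close> given \<open>A\<close>, so integrating against it is the elementary conditional expectation
  given \<open>A\<close>.\<close>

definition cond_expectation :: "'a measure \<Rightarrow> ('a \<Rightarrow> real) \<Rightarrow> ('a \<Rightarrow> bool) \<Rightarrow> real" where
  "cond_expectation D f P = (\<integral>z. f z \<partial>uniform_measure D {z \<in> space D. P z})"

definition b_coeff ::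
  "('p \<Rightarrow> 'y \<Rightarrow> real) \<Rightarrow> ('x \<times> 'y) measure \<Rightarrow> ('x \<Rightarrow> 'p) measure \<Rightarrow> ('x \<Rightarrow> 'p) \<Rightarrow> real" where
  "b_coeff loss D Q h =
    cond_expectation D (\<lambda>z. \<integral>h'. loss (h' (fst z)) (snd z) \<partial>Q) (\<lambda>z. loss (h (fst z)) (snd z) = 0)"

definition c_coeff ::
  "('p \<Rightarrow> 'y \<Rightarrow> real) \<Rightarrow> ('x \<times> 'y) measure \<Rightarrow> ('x \<Rightarrow> 'p) measure \<Rightarrow> ('x \<Rightarrow> 'p) \<Rightarrow> real" where
  "c_coeff loss D Q h =
    cond_expectation D (\<lambda>z. \<integral>h'. loss (h' (fst z)) (snd z) \<partial>Q) (\<lambda>z. loss (h (fst z)) (snd z) = 1)"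

text \<open>A sample of size \<open>m\<close> is a function on the indices \<open>{..<m}\<close>.\<close>

definition sample_law :: "'a measure \<Rightarrow> nat \<Rightarrow> (nat \<Rightarrow> 'a) measure" where
  "sample_law D m = (\<Pi>\<^sub>M i\<in>{..<m}. D)"

text \<open>The measurable space \<open>H\<close> has the hypothesis class as its underlying set;
  the points of \<^const>\<open>prob_algebra\<close> \<open>H\<close> are exactly the probability measures on \<open>H\<close>.\<close>

abbreviation distributions_over :: "'h measure \<Rightarrow> 'h measure set" where
  "distributions_over H \<equiv> space (prob_algebra H)"

end

(* Conditioning on whether h errs, with R the risk of h, gives for every Q the identity
   E_Q risk = (1 - R) * b_D + R * c_D (Fubini and total expectation). On the intersection of the
   three events this yields L >= (1 - R) * b + R * c, which is solved for R because c > b. *)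

theory Submission
  imports Defs
begin

text \<open>Conditioning reweights \<open>M\<close> by the density
  \<open>indicator ?A z / prob ?A\<close>, so multiplying by the probability of the event cancels
  the normalising constant.\<close>

lemma (in prob_space) cond_expectation_times_prob:
  fixes f :: "'a \<Rightarrow> real"
  assumes [measurable]: "f \<in> borel_measurable M" "Measurable.pred M P"
    and pos: "\<P>(z in M. P z) > 0"
  shows "\<P>(z in M. P z) * cond_expectation M f P = (\<integral>z. indicator {z \<in> space M. P z} z * f z \<partial>M)"
proof -
  let ?A = "{z \<in> space M. P z}"
  \<comment> \<open>The quotient defining \<open>uniform_measure\<close> is taken in
    \<open>ennreal\<close>. Positivity of \<open>prob ?A\<close> makes it agree with the real
    quotient, which is the form \<open>integral_density\<close> needs.\<close>
  have "uniform_measure M ?A = density M (\<lambda>z. ennreal (indicator ?A z / prob ?A))"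
    unfolding uniform_measure_def
    by (intro density_cong)
       (use pos in \<open>auto simp: emeasure_eq_measure divide_ennreal indicator_def
          simp flip: ennreal_1 split: if_splits\<close>)
  then have "cond_expectation M f P = (\<integral>z. indicator ?A z / prob ?A * f z \<partial>M)"
    unfolding cond_expectation_def by (simp add: integral_density)
  also have "\<dots> = (\<integral>z. indicator ?A z * f z \<partial>M) / prob ?A"
    by simp
  finally show ?thesis
    using pos by simp
qed

text \<open>Law of total expectation for the partition into \<open>g = 0\<close> and
  \<open>g = 1\<close>. Since \<open>g\<close> is its own indicator of the second event, the weights
  are expressible through \<open>expectation g\<close>, which becomes the risk of \<open>h\<close>
  later.\<close>

lemma (in prob_space) cond_expectation_total:
  fixes f g :: "'a \<Rightarrow> real"
  assumes f: "integrable M f" and [measurable]: "g \<in> borel_measurable M"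
    and g01: "\<And>z. z \<in> space M \<Longrightarrow> g z \<in> {0, 1}"
    and pos0: "\<P>(z in M. g z = 0) > 0" and pos1: "\<P>(z in M. g z = 1) > 0"
  shows "expectation f = (1 - expectation g) * cond_expectation M f (\<lambda>z. g z = 0)
    + expectation g * cond_expectation M f (\<lambda>z. g z = 1)"
proof -
  let ?A = "\<lambda>r. {z \<in> space M. g z = r}"
  have [measurable]: "f \<in> borel_measurable M" using f by simp
  have p1: "expectation g = prob (?A 1)"
  proof -
    have "expectation g = expectation (indicator (?A 1))"
      by (intro Bochner_Integration.integral_cong) (use g01 in \<open>auto simp: indicator_def\<close>)
    then show ?thesis by simp
  qed
  have "?A 0 = space M - ?A 1"
    using g01 by auto
  then have p0: "1 - expectation g = prob (?A 0)"
    unfolding p1 by (simp add: prob_compl)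
  have int: "integrable M (\<lambda>z. indicator (?A r) z * f z)" for r
    using integrable_mult_indicator[OF _ f, of "?A r"] by simp
  have "expectation f = (\<integral>z. indicator (?A 0) z * f z + indicator (?A 1) z * f z \<partial>M)"
    by (intro Bochner_Integration.integral_cong) (use g01 in \<open>auto simp: indicator_def\<close>)
  also have "\<dots> = prob (?A 0) * cond_expectation M f (\<lambda>z. g z = 0)
      + prob (?A 1) * cond_expectation M f (\<lambda>z. g z = 1)"
    using pos0 pos1 by (simp add: int cond_expectation_times_prob del: integral_mult_right_zero)
  \<comment> \<open>The order matters: \<open>p1\<close> would rewrite the
    \<open>expectation g\<close> inside the left-hand side of \<open>p0\<close>.\<close>
  finally show ?thesis
    by (simp only: p0) (simp only: p1)
qed

text \<open>The complement of \<open>E\<close> is covered by the complements of \<open>A\<close>,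
  \<open>B\<close> and \<open>C\<close>. Only \<open>E\<close> is assumed to be an event: the sets
  put for the other three quantify over all \<open>Q\<close>, possibly uncountably many, and may
  fail to be measurable.\<close>

lemma (in prob_space) prob_union_bound3:
  fixes \<delta>\<^sub>1 \<delta>\<^sub>2 \<delta>\<^sub>3 :: real
  assumes "A \<inter> B \<inter> C \<subseteq> E" "E \<in> events"
    and A: "prob A \<ge> 1 - \<delta>\<^sub>1" and B: "prob B \<ge> 1 - \<delta>\<^sub>2" and C: "prob C \<ge> 1 - \<delta>\<^sub>3"
    and nonneg: "\<delta>\<^sub>1 \<ge> 0" "\<delta>\<^sub>2 \<ge> 0" "\<delta>\<^sub>3 \<ge> 0"
  shows "prob E \<ge> 1 - (\<delta>\<^sub>1 + \<delta>\<^sub>2 + \<delta>\<^sub>3)"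
proof (cases "A \<in> events \<and> B \<in> events \<and> C \<in> events")
  case True
  then have [measurable]: "A \<in> events" "B \<in> events" "C \<in> events" by auto
  have "1 - prob E = prob (space M - E)"
    using assms(2) by (simp add: prob_compl)
  also have "\<dots> \<le> prob ((space M - A) \<union> (space M - B) \<union> (space M - C))"
    using assms(1) by (intro finite_measure_mono) auto
  also have "\<dots> \<le> prob (space M - A) + prob (space M - B) + prob (space M - C)"
    by (intro order_trans[OF measure_Un_le] add_right_mono measure_Un_le) auto
  also have "\<dots> \<le> \<delta>\<^sub>1 + \<delta>\<^sub>2 + \<delta>\<^sub>3"
    using A B C by (simp add: prob_compl)
  finally show ?thesis by simp
next
  case False
  \<comment> \<open>A non-measurable set has measure \<open>0\<close>, so its \<open>\<delta>\<close> is at least \<open>1\<close>.\<close>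
  then have "\<delta>\<^sub>1 \<ge> 1 \<or> \<delta>\<^sub>2 \<ge> 1 \<or> \<delta>\<^sub>3 \<ge> 1"
    using A B C by (auto simp: measure_notin_sets)
  then show ?thesis
    using nonneg measure_nonneg[of M E] by linarith
qed

text \<open>Fubini turns the \<open>Q\<close>-average of risks into the \<open>D\<close>-expectation
  of the \<open>Q\<close>-averaged loss; total expectation is then applied with the loss of
  \<open>h\<close> as the 0/1 function.\<close>

lemma expected_risk_decomposition:
  fixes loss :: "'p \<Rightarrow> 'y \<Rightarrow> real" and D :: "('x \<times> 'y) measure"
  assumes "prob_space D" and Q: "Q \<in> distributions_over H"
    and meas: "(\<lambda>(h', z). loss (h' (fst z)) (snd z)) \<in> borel_measurable (H \<Otimes>\<^sub>M D)"
    and loss01: "\<And>h' z. h' \<in> space H \<Longrightarrow> z \<in> space D \<Longrightarrow> loss (h' (fst z)) (snd z) \<in> {0, 1}"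
    and h: "h \<in> space H"
    and "\<P>(z in D. loss (h (fst z)) (snd z) = 0) > 0"
    and "\<P>(z in D. loss (h (fst z)) (snd z) = 1) > 0"
  shows "(\<integral>h'. risk loss D h' \<partial>Q)
    = (1 - risk loss D h) * b_coeff loss D Q h + risk loss D h * c_coeff loss D Q h"
proof -
  interpret D: prob_space D by fact
  have "prob_space Q" and sets_Q: "sets Q = sets H"
    using Q by (auto simp: space_prob_algebra)
  interpret Q: prob_space Q by fact
  interpret QD: pair_prob_space Q D ..
  let ?l = "\<lambda>h' z. loss (h' (fst z)) (snd z)"
  have "(\<lambda>(h', z). ?l h' z) \<in> borel_measurable (Q \<Otimes>\<^sub>M D)"
    using meas by (simp cong: measurable_cong_sets sets_pair_measure_cong add: sets_Q)
  \<comment> \<open>A bounded measurable function is integrable on the product of two probability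
    spaces, which is what Fubini requires.\<close>
  moreover have "norm (case x of (h', z) \<Rightarrow> ?l h' z) \<le> 1" if "x \<in> space (Q \<Otimes>\<^sub>M D)" for x
    using that loss01 sets_eq_imp_space_eq[OF sets_Q]
    by (force simp: space_pair_measure split: prod.splits)
  ultimately have int: "integrable (Q \<Otimes>\<^sub>M D) (\<lambda>(h', z). ?l h' z)"
    by (intro QD.integrable_const_bound[where B = 1]) auto
  have "(\<integral>h'. risk loss D h' \<partial>Q) = (\<integral>z. \<integral>h'. ?l h' z \<partial>Q \<partial>D)"
    unfolding risk_def using QD.Fubini_integral[OF int] by simp
  also have "\<dots> = (1 - risk loss D h) * b_coeff loss D Q h + risk loss D h * c_coeff loss D Q h"
    unfolding risk_def b_coeff_def c_coeff_def
  proof (rule D.cond_expectation_total)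
    show "integrable D (\<lambda>z. \<integral>h'. ?l h' z \<partial>Q)"
      using QD.integrable_snd[OF int] .
    \<comment> \<open>Joint measurability is restricted to the section at the point \<open>h\<close>
      of \<open>H\<close>.\<close>
    show "?l h \<in> borel_measurable D"
      using measurable_compose[OF measurable_Pair1'[OF h] meas] by simp
  qed (use assms in auto)
  finally show ?thesis .
qed

theorem corollary1:
  fixes X :: "'x measure" and Y :: "'y set" and Y' :: "'p set"
    and H :: "('x \<Rightarrow> 'p) measure"
    and loss :: "'p \<Rightarrow> 'y \<Rightarrow> real"
    and D :: "('x \<times> 'y) measure"
    and h :: "'x \<Rightarrow> 'p" and m :: nat
    and \<delta>\<^sub>1 \<delta>\<^sub>2 \<delta>\<^sub>3 :: real
    and L b c :: "(nat \<Rightarrow> 'x \<times> 'y) \<Rightarrow> ('x \<Rightarrow> 'p) measure \<Rightarrow> real"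
  assumes "finite Y"
    and "space H \<subseteq> space X \<rightarrow> Y'"
    and "\<And>p y. p \<in> Y' \<Longrightarrow> y \<in> Y \<Longrightarrow> loss p y \<in> {0, 1}"
    and loss_measurable:
      "(\<lambda>(h', z). loss (h' (fst z)) (snd z))
         \<in> borel_measurable (H \<Otimes>\<^sub>M (X \<Otimes>\<^sub>M count_space Y))"
    and "prob_space D" and "sets D = sets (X \<Otimes>\<^sub>M count_space Y)"
    and "h \<in> space H"
    and b_well_defined: "\<P>(z in D. loss (h (fst z)) (snd z) = 0) > 0"
    and c_well_defined: "\<P>(z in D. loss (h (fst z)) (snd z) = 1) > 0"
    and "m \<ge> 1"
    and "\<delta>\<^sub>1 \<in> {0..1}" and "\<delta>\<^sub>2 \<in> {0..1}" and "\<delta>\<^sub>3 \<in> {0..1}"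
    and L_bound: "\<P>(S in sample_law D m. \<forall>Q\<in>distributions_over H.
          (\<integral>h'. risk loss D h' \<partial>Q) \<le> L S Q) \<ge> 1 - \<delta>\<^sub>1"
    and b_bound: "\<P>(S in sample_law D m. \<forall>Q\<in>distributions_over H.
          b_coeff loss D Q h \<ge> b S Q) \<ge> 1 - \<delta>\<^sub>2"
    and c_bound: "\<P>(S in sample_law D m. \<forall>Q\<in>distributions_over H.
          c_coeff loss D Q h \<ge> c S Q) \<ge> 1 - \<delta>\<^sub>3"
    and "\<And>S Q. S \<in> space (sample_law D m) \<Longrightarrow> Q \<in> distributions_over H \<Longrightarrow> c S Q > b S Q"
    and conclusion_event_measurable:
      "{S \<in> space (sample_law D m). \<forall>Q\<in>distributions_over H.
          risk loss D h \<le> (L S Q - b S Q) / (c S Q - b S Q)} \<in> sets (sample_law D m)"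
  shows "\<P>(S in sample_law D m. \<forall>Q\<in>distributions_over H.
          risk loss D h \<le> (L S Q - b S Q) / (c S Q - b S Q)) \<ge> 1 - (\<delta>\<^sub>1 + \<delta>\<^sub>2 + \<delta>\<^sub>3)"
proof -
  have space_D: "space D = space X \<times> Y"
    using sets_eq_imp_space_eq[OF \<open>sets D = _\<close>] by (simp add: space_pair_measure)
  have loss01: "loss (h' (fst z)) (snd z) \<in> {0, 1}" if "h' \<in> space H" "z \<in> space D" for h' z
    using that assms(2,3) unfolding space_D
    by (intro assms(3)) (auto simp: Pi_iff subset_iff)
  have meas: "(\<lambda>(h', z). loss (h' (fst z)) (snd z)) \<in> borel_measurable (H \<Otimes>\<^sub>M D)"
    using loss_measurable \<open>sets D = _\<close>
    by (simp cong: measurable_cong_sets sets_pair_measure_cong)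
  have "prob_space (sample_law D m)"
    unfolding sample_law_def using \<open>prob_space D\<close> by (intro prob_space_PiM)
  then interpret S: prob_space "sample_law D m" .
  interpret D: prob_space D by fact
  \<comment> \<open>With the upper bound \<open>risk1\<close>, this makes both weights
    \<open>1 - risk loss D h\<close> and \<open>risk loss D h\<close> nonnegative, so lower bounds
    on the coefficients can be inserted.\<close>
  have risk0: "risk loss D h \<ge> 0"
    unfolding risk_def
    by (intro Bochner_Integration.integral_nonneg) (use loss01[OF \<open>h \<in> space H\<close>] in force)
  have risk1: "risk loss D h \<le> 1"
    unfolding risk_def
    using loss01[OF \<open>h \<in> space H\<close>]
      measurable_compose[OF measurable_Pair1'[OF \<open>h \<in> space H\<close>] meas]
    by (intro D.integral_le_const D.integrable_const_bound[where B = 1] AE_I2) force+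
  \<comment> \<open>This is deterministic, for one fixed \<open>S\<close> and \<open>Q\<close>;
    probability enters only through the final union bound.\<close>
  have bound: "risk loss D h \<le> (L S Q - b S Q) / (c S Q - b S Q)"
    if "S \<in> space (sample_law D m)" and Q: "Q \<in> distributions_over H"
      and L: "(\<integral>h'. risk loss D h' \<partial>Q) \<le> L S Q"
      and b: "b_coeff loss D Q h \<ge> b S Q" and c: "c_coeff loss D Q h \<ge> c S Q" for S Q
  proof -
    have "(1 - risk loss D h) * b S Q + risk loss D h * c S Q
      \<le> (1 - risk loss D h) * b_coeff loss D Q h + risk loss D h * c_coeff loss D Q h"
      using b c risk0 risk1 by (intro add_mono mult_left_mono) auto
    also have "\<dots> = (\<integral>h'. risk loss D h' \<partial>Q)"
      by (rule expected_risk_decomposition[symmetric]) (use assms Q meas loss01 in blast)+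
    \<comment> \<open>Collecting the terms in the risk of \<open>h\<close> leaves the factor
      \<open>c S Q - b S Q\<close>, whose positivity permits the division.\<close>
    finally have "risk loss D h * (c S Q - b S Q) \<le> L S Q - b S Q"
      using L by (simp add: algebra_simps)
    moreover have "c S Q > b S Q"
      using assms that by blast
    ultimately show ?thesis
      by (simp add: pos_le_divide_eq)
  qed
  \<comment> \<open>By \<open>bound\<close>, any sample in all three good events lies in the target
    event, for every \<open>Q\<close> at once.\<close>
  show ?thesis
    by (rule S.prob_union_bound3[OF _ conclusion_event_measurable L_bound b_bound c_bound])
       (use bound assms in auto)
qed

end
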